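(* Let $(N',\phi',\xi',\eta',g')$ be an almost para-contact metric manifold, let $(M_1,g_1,J_1)$ be a metallic Riemannian manifold with $J_1^2=pJ_1+qI$, where $p,q$ are positive integers, and let $F:N'\to M_1$ be a smooth map such that $F_*\phi'=J_1F_*$. If $p^2\neq(q-1)^2$, then $F$ is a constant map.
   Context: All manifolds and maps are $C^\infty$; $F_*$ is the differential of $F$. A metallic Riemannian manifold $(M,g,J)$ is a Riemannian manifold $(M,g)$ with a $(1,1)$-tensor field $J$ such that $J^2=pJ+qI$ for some positive integers $p,q$ ($I$ the identity) and $g(JX,Y)=g(X,JY)$ for all vector fields $X,Y$; it is assumed throughout that $\nabla J=0$ for the Levi-Civita connection $\nabla$ of $g$. An almost para-contact metric manifold $(N',\phi',\xi',\eta',g')$ is a $(2n+1)$-dimensional manifold $N'$ with a $(1,1)$-tensor field $\phi'$, a vector field $\xi'$, a $1$-form $\eta'$ and a pseudo-Riemannian metric $g'$ of signature $(n+1,n)$ such that $\phi'^2=I-\eta'\otimes\xi'$, $\eta'(\xi')=1$ and $g'(\phi'X,\phi'Y)=-g'(X,Y)+\eta'(X)\eta'(Y)$ for all vector fields $X,Y$; it then satisfies $\phi'(\xi')=0$, $\eta'\circ\phi'=0$, $\eta'(X)=g'(X,\xi')$, $g'(\xi',\xi')=1$ and $g'(\phi'X,Y)=-g'(\phi'Y,X)$.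
   Formalization: The manifold N' is additionally assumed connected; without this the claim fails, since a map taking different constant values on two components of N' satisfies F_*φ'=J_1F_* (both sides vanish) without being constant. *)

theory Defs
  imports "HOL-Analysis.Analysis"
begin

section \<open>Smooth functions between normed spaces\<close>

text \<open>
  These notions are used for open sets and finite-dimensional domains only; there, continuity
  of all iterated directional derivatives is the usual smoothness.
\<close>

primrec Ck_on :: "nat \<Rightarrow> 'e::real_normed_vector set \<Rightarrow> ('e \<Rightarrow> 'f::real_normed_vector) \<Rightarrow> bool" where
  "Ck_on 0 S f \<longleftrightarrow> continuous_on S f"
| "Ck_on (Suc k) S f \<longleftrightarrow>
     (\<forall>x\<in>S. f differentiable at x) \<and> (\<forall>v. Ck_on k S (\<lambda>x. frechet_derivative f (at x) v))"

definition smooth_on :: "'e::real_normed_vector set \<Rightarrow> ('e \<Rightarrow> 'f::real_normed_vector) \<Rightarrow> bool" where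
  "smooth_on S f \<longleftrightarrow> (\<forall>k. Ck_on k S f)"

section \<open>Smooth manifolds and smooth maps\<close>

text \<open>
  A chart is a pair of its domain and its coordinate map; the values of the coordinate map
  outside the domain are irrelevant. The model space is a finite-dimensional real normed space,
  so that all dimensions, 0 included, are covered. The atlas need not be maximal.
\<close>

type_synonym ('a, 'e) chart = "'a set \<times> ('a \<Rightarrow> 'e)"

record ('a, 'e) manifold =
  mtop :: "'a topology"
  atlas :: "('a, 'e) chart set"

abbreviation points :: "('a, 'e) manifold \<Rightarrow> 'a set" where
  "points M \<equiv> topspace (mtop M)"

abbreviation chart_inv :: "('a, 'e) chart \<Rightarrow> 'e \<Rightarrow> 'a" where
  "chart_inv \<kappa> \<equiv> inv_into (fst \<kappa>) (snd \<kappa>)"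

definition transition :: "('a, 'e) chart \<Rightarrow> ('a, 'e) chart \<Rightarrow> 'e \<Rightarrow> 'e" where
  "transition \<kappa> \<kappa>' = snd \<kappa>' \<circ> chart_inv \<kappa>"

definition smooth_manifold :: "('a, 'e::real_normed_vector) manifold \<Rightarrow> bool" where
  "smooth_manifold M \<longleftrightarrow>
     (\<exists>B::'e set. finite B \<and> span B = UNIV) \<and>
     Hausdorff_space (mtop M) \<and> second_countable (mtop M) \<and>
     (\<Union>\<kappa>\<in>atlas M. fst \<kappa>) = points M \<and>
     (\<forall>\<kappa>\<in>atlas M. openin (mtop M) (fst \<kappa>) \<and> open (snd \<kappa> ` fst \<kappa>) \<and>
        homeomorphic_map (subtopology (mtop M) (fst \<kappa>)) (top_of_set (snd \<kappa> ` fst \<kappa>)) (snd \<kappa>)) \<and>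
     (\<forall>\<kappa>\<in>atlas M. \<forall>\<kappa>'\<in>atlas M. smooth_on (snd \<kappa> ` (fst \<kappa> \<inter> fst \<kappa>')) (transition \<kappa> \<kappa>'))"

definition manifold_dim :: "('a, 'e::real_normed_vector) manifold \<Rightarrow> nat" where
  "manifold_dim M = dim (UNIV :: 'e set)"

definition charts_at :: "('a, 'e) manifold \<Rightarrow> 'a \<Rightarrow> ('a, 'e) chart set" where
  "charts_at M x = {\<kappa> \<in> atlas M. x \<in> fst \<kappa>}"

definition smooth_map ::
  "('a, 'e::real_normed_vector) manifold \<Rightarrow> ('b, 'f::real_normed_vector) manifold \<Rightarrow> ('a \<Rightarrow> 'b) \<Rightarrow> bool"
  where
  "smooth_map M N F \<longleftrightarrow>
     continuous_map (mtop M) (mtop N) F \<and>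
     (\<forall>\<kappa>\<in>atlas M. \<forall>\<kappa>'\<in>atlas N.
        smooth_on (snd \<kappa> ` (fst \<kappa> \<inter> F -` fst \<kappa>')) (snd \<kappa>' \<circ> F \<circ> chart_inv \<kappa>))"

definition smooth_fun :: "('a, 'e::real_normed_vector) manifold \<Rightarrow> ('a \<Rightarrow> real) \<Rightarrow> bool" where
  "smooth_fun M f \<longleftrightarrow> (\<forall>\<kappa>\<in>atlas M. smooth_on (snd \<kappa> ` fst \<kappa>) (f \<circ> chart_inv \<kappa>))"

section \<open>Tangent vectors, differentials, vector fields\<close>

text \<open>
  A tangent vector at \<open>x\<close> is the family of its coordinate representations in all charts around
  \<open>x\<close>, related by the derivatives of the transition maps (and 0 at all other charts, to make the
  family unique). The vector space operations are pointwise.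
\<close>

type_synonym ('a, 'e) tangent = "('a, 'e) chart \<Rightarrow> 'e"

definition tangent_space :: "('a, 'e::real_normed_vector) manifold \<Rightarrow> 'a \<Rightarrow> ('a, 'e) tangent set" where
  "tangent_space M x =
     {v. (\<forall>\<kappa>. \<kappa> \<notin> charts_at M x \<longrightarrow> v \<kappa> = 0) \<and>
         (\<forall>\<kappa>\<in>charts_at M x. \<forall>\<kappa>'\<in>charts_at M x.
            v \<kappa>' = frechet_derivative (transition \<kappa> \<kappa>') (at (snd \<kappa> x)) (v \<kappa>))}"

definition tadd :: "('a, 'e::real_normed_vector) tangent \<Rightarrow> ('a, 'e) tangent \<Rightarrow> ('a, 'e) tangent" where
  "tadd v w = (\<lambda>\<kappa>. v \<kappa> + w \<kappa>)"

definition tscale :: "real \<Rightarrow> ('a, 'e::real_normed_vector) tangent \<Rightarrow> ('a, 'e) tangent" where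
  "tscale c v = (\<lambda>\<kappa>. c *\<^sub>R v \<kappa>)"

definition tdiff :: "('a, 'e::real_normed_vector) tangent \<Rightarrow> ('a, 'e) tangent \<Rightarrow> ('a, 'e) tangent" where
  "tdiff v w = (\<lambda>\<kappa>. v \<kappa> - w \<kappa>)"

definition tzero :: "('a, 'e::real_normed_vector) tangent" where
  "tzero = (\<lambda>\<kappa>. 0)"

text \<open>
  By the chain rule, the following two definitions do not depend on the choice of the chart.
\<close>

definition differential ::
  "('a, 'e::real_normed_vector) manifold \<Rightarrow> ('b, 'f::real_normed_vector) manifold \<Rightarrow> ('a \<Rightarrow> 'b) \<Rightarrow>
     'a \<Rightarrow> ('a, 'e) tangent \<Rightarrow> ('b, 'f) tangent" where
  "differential M N F x v =
     (let \<kappa> = (SOME \<kappa>. \<kappa> \<in> charts_at M x) in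
      (\<lambda>\<kappa>'. if \<kappa>' \<in> charts_at N (F x)
            then frechet_derivative (snd \<kappa>' \<circ> F \<circ> chart_inv \<kappa>) (at (snd \<kappa> x)) (v \<kappa>)
            else 0))"

definition dir_deriv ::
  "('a, 'e::real_normed_vector) manifold \<Rightarrow> ('a \<Rightarrow> real) \<Rightarrow> 'a \<Rightarrow> ('a, 'e) tangent \<Rightarrow> real" where
  "dir_deriv M f x v =
     (let \<kappa> = (SOME \<kappa>. \<kappa> \<in> charts_at M x) in
      frechet_derivative (f \<circ> chart_inv \<kappa>) (at (snd \<kappa> x)) (v \<kappa>))"

definition vector_field ::
  "('a, 'e::real_normed_vector) manifold \<Rightarrow> ('a \<Rightarrow> ('a, 'e) tangent) \<Rightarrow> bool" where
  "vector_field M X \<longleftrightarrow>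
     (\<forall>x\<in>points M. X x \<in> tangent_space M x) \<and>
     (\<forall>\<kappa>\<in>atlas M. smooth_on (snd \<kappa> ` fst \<kappa>) (\<lambda>u. X (chart_inv \<kappa> u) \<kappa>))"

definition lie_bracket ::
  "('a, 'e::real_normed_vector) manifold \<Rightarrow> ('a \<Rightarrow> ('a, 'e) tangent) \<Rightarrow> ('a \<Rightarrow> ('a, 'e) tangent) \<Rightarrow>
     'a \<Rightarrow> ('a, 'e) tangent" where
  "lie_bracket M X Y x =
     (\<lambda>\<kappa>. if \<kappa> \<in> charts_at M x
          then frechet_derivative (\<lambda>u. Y (chart_inv \<kappa> u) \<kappa>) (at (snd \<kappa> x)) (X x \<kappa>)
             - frechet_derivative (\<lambda>u. X (chart_inv \<kappa> u) \<kappa>) (at (snd \<kappa> x)) (Y x \<kappa>)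
          else 0)"

section \<open>Tensor fields\<close>

text \<open>
  Smoothness of a tensor field is expressed by its action on smooth vector fields.
\<close>

definition tensor_field_11 ::
  "('a, 'e::real_normed_vector) manifold \<Rightarrow> ('a \<Rightarrow> ('a, 'e) tangent \<Rightarrow> ('a, 'e) tangent) \<Rightarrow> bool" where
  "tensor_field_11 M J \<longleftrightarrow>
     (\<forall>x\<in>points M. \<forall>v\<in>tangent_space M x.
        J x v \<in> tangent_space M x \<and>
        (\<forall>w\<in>tangent_space M x. J x (tadd v w) = tadd (J x v) (J x w)) \<and>
        (\<forall>c. J x (tscale c v) = tscale c (J x v))) \<and>
     (\<forall>X. vector_field M X \<longrightarrow> vector_field M (\<lambda>x. J x (X x)))"

definition one_form ::
  "('a, 'e::real_normed_vector) manifold \<Rightarrow> ('a \<Rightarrow> ('a, 'e) tangent \<Rightarrow> real) \<Rightarrow> bool" where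
  "one_form M \<eta> \<longleftrightarrow>
     (\<forall>x\<in>points M. \<forall>v\<in>tangent_space M x.
        (\<forall>w\<in>tangent_space M x. \<eta> x (tadd v w) = \<eta> x v + \<eta> x w) \<and>
        (\<forall>c. \<eta> x (tscale c v) = c * \<eta> x v)) \<and>
     (\<forall>X. vector_field M X \<longrightarrow> smooth_fun M (\<lambda>x. \<eta> x (X x)))"

definition symmetric_tensor_field_02 ::
  "('a, 'e::real_normed_vector) manifold \<Rightarrow> ('a \<Rightarrow> ('a, 'e) tangent \<Rightarrow> ('a, 'e) tangent \<Rightarrow> real) \<Rightarrow> bool"
  where
  "symmetric_tensor_field_02 M g \<longleftrightarrow>
     (\<forall>x\<in>points M. \<forall>v\<in>tangent_space M x. \<forall>w\<in>tangent_space M x.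
        g x v w = g x w v \<and>
        (\<forall>u\<in>tangent_space M x. g x (tadd v u) w = g x v w + g x u w) \<and>
        (\<forall>c. g x (tscale c v) w = c * g x v w)) \<and>
     (\<forall>X Y. vector_field M X \<longrightarrow> vector_field M Y \<longrightarrow> smooth_fun M (\<lambda>x. g x (X x) (Y x)))"

definition riemannian_metric ::
  "('a, 'e::real_normed_vector) manifold \<Rightarrow> ('a \<Rightarrow> ('a, 'e) tangent \<Rightarrow> ('a, 'e) tangent \<Rightarrow> real) \<Rightarrow> bool"
  where
  "riemannian_metric M g \<longleftrightarrow>
     symmetric_tensor_field_02 M g \<and>
     (\<forall>x\<in>points M. \<forall>v\<in>tangent_space M x. v \<noteq> tzero \<longrightarrow> g x v v > 0)"

text \<open>
  Signature \<open>(r, s)\<close>: every tangent space has an orthonormal basis with \<open>r\<close> vectors of square 1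
  and \<open>s\<close> vectors of square -1. Linear independence follows from orthonormality.
\<close>

definition pseudo_riemannian_metric ::
  "('a, 'e::real_normed_vector) manifold \<Rightarrow> ('a \<Rightarrow> ('a, 'e) tangent \<Rightarrow> ('a, 'e) tangent \<Rightarrow> real) \<Rightarrow>
     nat \<Rightarrow> nat \<Rightarrow> bool"
  where
  "pseudo_riemannian_metric M g r s \<longleftrightarrow>
     symmetric_tensor_field_02 M g \<and>
     (\<forall>x\<in>points M. \<exists>e :: nat \<Rightarrow> ('a, 'e) tangent.
        (\<forall>i<r+s. e i \<in> tangent_space M x) \<and>
        (\<forall>i<r+s. \<forall>j<r+s. g x (e i) (e j) = (if i = j then (if i < r then 1 else -1) else 0)) \<and>
        (\<forall>v\<in>tangent_space M x. \<exists>c :: nat \<Rightarrow> real. v = (\<lambda>\<kappa>. \<Sum>i<r+s. c i *\<^sub>R e i \<kappa>)))"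

section \<open>The Levi-Civita connection\<close>

definition affine_connection ::
  "('a, 'e::real_normed_vector) manifold \<Rightarrow>
     (('a \<Rightarrow> ('a, 'e) tangent) \<Rightarrow> ('a \<Rightarrow> ('a, 'e) tangent) \<Rightarrow> ('a \<Rightarrow> ('a, 'e) tangent)) \<Rightarrow> bool" where
  "affine_connection M nabla \<longleftrightarrow>
     (\<forall>X Y. vector_field M X \<longrightarrow> vector_field M Y \<longrightarrow> vector_field M (nabla X Y)) \<and>
     (\<forall>X Y Z. vector_field M X \<longrightarrow> vector_field M Y \<longrightarrow> vector_field M Z \<longrightarrow>
        (\<forall>x\<in>points M.
           nabla (\<lambda>y. tadd (X y) (Y y)) Z x = tadd (nabla X Z x) (nabla Y Z x) \<and>
           nabla X (\<lambda>y. tadd (Y y) (Z y)) x = tadd (nabla X Y x) (nabla X Z x))) \<and>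
     (\<forall>f X Y. smooth_fun M f \<longrightarrow> vector_field M X \<longrightarrow> vector_field M Y \<longrightarrow>
        (\<forall>x\<in>points M.
           nabla (\<lambda>y. tscale (f y) (X y)) Y x = tscale (f x) (nabla X Y x) \<and>
           nabla X (\<lambda>y. tscale (f y) (Y y)) x =
             tadd (tscale (dir_deriv M f x (X x)) (Y x)) (tscale (f x) (nabla X Y x))))"

definition levi_civita_connection ::
  "('a, 'e::real_normed_vector) manifold \<Rightarrow> ('a \<Rightarrow> ('a, 'e) tangent \<Rightarrow> ('a, 'e) tangent \<Rightarrow> real) \<Rightarrow>
     (('a \<Rightarrow> ('a, 'e) tangent) \<Rightarrow> ('a \<Rightarrow> ('a, 'e) tangent) \<Rightarrow> ('a \<Rightarrow> ('a, 'e) tangent)) \<Rightarrow> bool" where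
  "levi_civita_connection M g nabla \<longleftrightarrow>
     affine_connection M nabla \<and>
     (\<forall>X Y. vector_field M X \<longrightarrow> vector_field M Y \<longrightarrow>
        (\<forall>x\<in>points M. tdiff (nabla X Y x) (nabla Y X x) = lie_bracket M X Y x)) \<and>
     (\<forall>X Y Z. vector_field M X \<longrightarrow> vector_field M Y \<longrightarrow> vector_field M Z \<longrightarrow>
        (\<forall>x\<in>points M. dir_deriv M (\<lambda>y. g y (Y y) (Z y)) x (X x) =
           g x (nabla X Y x) (Z x) + g x (Y x) (nabla X Z x)))"

definition parallel_11 ::
  "('a, 'e::real_normed_vector) manifold \<Rightarrow>
     (('a \<Rightarrow> ('a, 'e) tangent) \<Rightarrow> ('a \<Rightarrow> ('a, 'e) tangent) \<Rightarrow> ('a \<Rightarrow> ('a, 'e) tangent)) \<Rightarrow>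
     ('a \<Rightarrow> ('a, 'e) tangent \<Rightarrow> ('a, 'e) tangent) \<Rightarrow> bool" where
  "parallel_11 M nabla J \<longleftrightarrow>
     (\<forall>X Y. vector_field M X \<longrightarrow> vector_field M Y \<longrightarrow>
        (\<forall>x\<in>points M. tdiff (nabla X (\<lambda>y. J y (Y y)) x) (J x (nabla X Y x)) = tzero))"

section \<open>Metallic Riemannian and almost para-contact metric manifolds\<close>

text \<open>
  By the fundamental theorem of Riemannian geometry the Levi-Civita connection of \<open>g\<close> exists and is
  unique, so the existential quantifier below just names it.
\<close>

definition metallic_riemannian_manifold ::
  "('a, 'e::real_normed_vector) manifold \<Rightarrow> ('a \<Rightarrow> ('a, 'e) tangent \<Rightarrow> ('a, 'e) tangent \<Rightarrow> real) \<Rightarrow>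
     ('a \<Rightarrow> ('a, 'e) tangent \<Rightarrow> ('a, 'e) tangent) \<Rightarrow> nat \<Rightarrow> nat \<Rightarrow> bool" where
  "metallic_riemannian_manifold M g J p q \<longleftrightarrow>
     smooth_manifold M \<and> riemannian_metric M g \<and> tensor_field_11 M J \<and> p > 0 \<and> q > 0 \<and>
     (\<forall>x\<in>points M. \<forall>v\<in>tangent_space M x.
        J x (J x v) = tadd (tscale (real p) (J x v)) (tscale (real q) v)) \<and>
     (\<forall>x\<in>points M. \<forall>v\<in>tangent_space M x. \<forall>w\<in>tangent_space M x.
        g x (J x v) w = g x v (J x w)) \<and>
     (\<exists>nabla. levi_civita_connection M g nabla \<and> parallel_11 M nabla J)"

definition almost_paracontact_metric_manifold ::
  "('a, 'e::real_normed_vector) manifold \<Rightarrow> nat \<Rightarrow> ('a \<Rightarrow> ('a, 'e) tangent \<Rightarrow> ('a, 'e) tangent) \<Rightarrow>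
     ('a \<Rightarrow> ('a, 'e) tangent) \<Rightarrow> ('a \<Rightarrow> ('a, 'e) tangent \<Rightarrow> real) \<Rightarrow>
     ('a \<Rightarrow> ('a, 'e) tangent \<Rightarrow> ('a, 'e) tangent \<Rightarrow> real) \<Rightarrow> bool" where
  "almost_paracontact_metric_manifold N n \<phi> \<xi> \<eta> g \<longleftrightarrow>
     smooth_manifold N \<and> manifold_dim N = 2 * n + 1 \<and>
     tensor_field_11 N \<phi> \<and> vector_field N \<xi> \<and> one_form N \<eta> \<and>
     pseudo_riemannian_metric N g (n + 1) n \<and>
     (\<forall>x\<in>points N. \<forall>v\<in>tangent_space N x. \<phi> x (\<phi> x v) = tdiff v (tscale (\<eta> x v) (\<xi> x))) \<and>
     (\<forall>x\<in>points N. \<eta> x (\<xi> x) = 1) \<and>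
     (\<forall>x\<in>points N. \<forall>v\<in>tangent_space N x. \<forall>w\<in>tangent_space N x.
        g x (\<phi> x v) (\<phi> x w) = - g x v w + \<eta> x v * \<eta> x w)"

end

theory Submission
  imports Defs
begin

text \<open>
  The argument is linear algebra on each tangent space. From
  \<open>\<phi>\<^sup>2 \<xi> = \<xi> - \<eta>(\<xi>) \<xi> = 0\<close> we get \<open>J\<^sup>2 F\<^sub>* \<xi> = 0\<close>, hence \<open>F\<^sub>* \<xi> = 0\<close> because
  \<open>J\<^sup>2 = p J + q I\<close> with \<open>q \<noteq> 0\<close> makes \<open>J\<close> injective. Applying \<open>F\<^sub>*\<close> to \<open>\<phi>\<^sup>2 v = v - \<eta>(v) \<xi>\<close>
  then gives \<open>J\<^sup>2 w = w\<close> for \<open>w = F\<^sub>* v\<close>, so \<open>p J w = (1 - q) w\<close> and \<open>p\<^sup>2 w = (q - 1)\<^sup>2 w\<close>.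
  Thus \<open>F\<^sub>* = 0\<close>, and \<open>F\<close> is locally constant on a connected space.
\<close>

section \<open>Coordinate representatives of maps and the chain rule\<close>

text \<open>The same expression occurs in \<open>smooth_map\<close> and in
  \<open>differential\<close>, and for \<open>F = id\<close> it is \<open>transition\<close>.
  Treating changes of chart as representatives of the identity lets one chain rule serve all
  cases.\<close>

definition chart_rep :: "('a \<Rightarrow> 'b) \<Rightarrow> ('a, 'e) chart \<Rightarrow> ('b, 'f) chart \<Rightarrow> 'e \<Rightarrow> 'f" where
  "chart_rep F \<kappa> \<kappa>' = snd \<kappa>' \<circ> F \<circ> chart_inv \<kappa>"

lemma chart_rep_id: "chart_rep id \<kappa> \<kappa>' = transition \<kappa> \<kappa>'"
  by (simp add: chart_rep_def transition_def)

lemma charts_atD: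
  assumes "\<kappa> \<in> charts_at M x"
  shows "\<kappa> \<in> atlas M" "x \<in> fst \<kappa>"
  using assms by (auto simp: charts_at_def)

lemma charts_at_nonempty:
  assumes "smooth_manifold M" "x \<in> points M"
  obtains \<kappa> where "\<kappa> \<in> charts_at M x"
  using assms unfolding smooth_manifold_def charts_at_def by blast

lemma chart_openin:
  assumes "smooth_manifold M" "\<kappa> \<in> atlas M"
  shows "openin (mtop M) (fst \<kappa>)"
  using assms unfolding smooth_manifold_def by blast

lemma chart_homeo:
  assumes "smooth_manifold M" "\<kappa> \<in> atlas M"
  shows "homeomorphic_map (subtopology (mtop M) (fst \<kappa>)) (top_of_set (snd \<kappa> ` fst \<kappa>)) (snd \<kappa>)"
  using assms unfolding smooth_manifold_def by blast

lemma chart_inj: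
  assumes "smooth_manifold M" "\<kappa> \<in> atlas M"
  shows "inj_on (snd \<kappa>) (fst \<kappa>)"
proof -
  have "fst \<kappa> \<subseteq> points M"
    using chart_openin[OF assms] by (rule openin_subset)
  then show ?thesis
    using homeomorphic_imp_injective_map[OF chart_homeo[OF assms]]
    by (simp add: Int_absorb1)
qed

lemma chart_inv_chart:
  assumes "smooth_manifold M" "\<kappa> \<in> atlas M" "x \<in> fst \<kappa>"
  shows "chart_inv \<kappa> (snd \<kappa> x) = x"
  using chart_inj[OF assms(1,2)] assms(3) by (rule inv_into_f_f)

text \<open>A chart is a homeomorphism onto an open set of the model space, so openness relative to
  its image is openness in the model space.\<close>

lemma chart_image_open:
  assumes "smooth_manifold M" "\<kappa> \<in> atlas M" "openin (mtop M) A"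
  shows "open (snd \<kappa> ` (fst \<kappa> \<inter> A))"
proof -
  have "openin (subtopology (mtop M) (fst \<kappa>)) (fst \<kappa> \<inter> A)"
    using assms(3) by (rule openin_subtopology_Int2)
  then have "openin (top_of_set (snd \<kappa> ` fst \<kappa>)) (snd \<kappa> ` (fst \<kappa> \<inter> A))"
    using homeomorphic_imp_open_map[OF chart_homeo[OF assms(1,2)]]
    unfolding open_map_def by blast
  moreover have "open (snd \<kappa> ` fst \<kappa>)"
    using assms(1,2) unfolding smooth_manifold_def by blast
  ultimately show ?thesis
    using openin_open_trans by blast
qed

lemma smooth_map_preimage_openin:
  assumes "smooth_manifold M" "smooth_map N M F" "\<kappa> \<in> atlas M"
  shows "openin (mtop N) {x \<in> points N. F x \<in> fst \<kappa>}"
  using assms(2) chart_openin[OF assms(1,3)] openin_continuous_map_preimage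
  unfolding smooth_map_def by blast

lemma smooth_map_points:
  assumes "smooth_map N M F" "x \<in> points N"
  shows "F x \<in> points M"
proof -
  have "continuous_map (mtop N) (mtop M) F"
    using assms(1) by (simp add: smooth_map_def)
  then show ?thesis
    using assms(2) continuous_map_image_subset_topspace by blast
qed

lemma smooth_map_id:
  assumes "smooth_manifold M"
  shows "smooth_map M M id"
  using assms unfolding smooth_map_def smooth_manifold_def transition_def
  by simp

lemma chart_rep_has_derivative:
  assumes "smooth_map N M F" "\<kappa> \<in> charts_at N x" "\<kappa>' \<in> charts_at M (F x)"
  shows "(chart_rep F \<kappa> \<kappa>' has_derivative frechet_derivative (chart_rep F \<kappa> \<kappa>') (at (snd \<kappa> x)))
           (at (snd \<kappa> x))"
proof -
  have "smooth_on (snd \<kappa> ` (fst \<kappa> \<inter> F -` fst \<kappa>')) (chart_rep F \<kappa> \<kappa>')"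
    using assms unfolding smooth_map_def chart_rep_def charts_at_def by blast
  then have "Ck_on (Suc 0) (snd \<kappa> ` (fst \<kappa> \<inter> F -` fst \<kappa>')) (chart_rep F \<kappa> \<kappa>')"
    unfolding smooth_on_def by blast
  moreover have "snd \<kappa> x \<in> snd \<kappa> ` (fst \<kappa> \<inter> F -` fst \<kappa>')"
    using assms(2,3) by (auto simp: charts_at_def)
  ultimately have "chart_rep F \<kappa> \<kappa>' differentiable at (snd \<kappa> x)"
    unfolding Ck_on.simps(2) by blast
  then show ?thesis
    by (simp add: frechet_derivative_works)
qed

text \<open>The chain rule through the intermediate chart \<open>\<kappa>'\<close>. With
  \<open>G = id\<close> it changes the chart in the target, with \<open>F = id\<close> the chart in
  the source.\<close>

lemma chart_rep_compose_derivative: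
  assumes N: "smooth_manifold N" and M: "smooth_manifold M"
    and F: "smooth_map N M F" and G: "smooth_map M L G"
    and \<kappa>: "\<kappa> \<in> charts_at N x" and \<kappa>': "\<kappa>' \<in> charts_at M (F x)"
    and \<kappa>'': "\<kappa>'' \<in> charts_at L (G (F x))"
  shows "frechet_derivative (chart_rep (G \<circ> F) \<kappa> \<kappa>'') (at (snd \<kappa> x)) v =
    frechet_derivative (chart_rep G \<kappa>' \<kappa>'') (at (snd \<kappa>' (F x)))
      (frechet_derivative (chart_rep F \<kappa> \<kappa>') (at (snd \<kappa> x)) v)"
proof -
  \<comment> \<open>On \<open>A\<close> the inner value lies in the domain of
    \<open>\<kappa>'\<close>, so \<open>chart_inv \<kappa>'\<close> undoes
    \<open>snd \<kappa>'\<close>. Outside \<open>A\<close> the two sides of \<open>eq\<close> may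
    differ; openness of the image of \<open>A\<close> is what lets the derivative be
    transferred.\<close>
  define A where "A = {y \<in> points N. F y \<in> fst \<kappa>'}"
  have "x \<in> A"
    using charts_atD[OF \<kappa>] charts_atD[OF \<kappa>'] openin_subset[OF chart_openin[OF N charts_atD(1)[OF \<kappa>]]]
    by (auto simp: A_def)
  have op: "open (snd \<kappa> ` (fst \<kappa> \<inter> A))"
    unfolding A_def
    by (rule chart_image_open[OF N charts_atD(1)[OF \<kappa>]
        smooth_map_preimage_openin[OF M F charts_atD(1)[OF \<kappa>']]])
  have eq: "(chart_rep G \<kappa>' \<kappa>'' \<circ> chart_rep F \<kappa> \<kappa>') u = chart_rep (G \<circ> F) \<kappa> \<kappa>'' u"
    if "u \<in> snd \<kappa> ` (fst \<kappa> \<inter> A)" for u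
    using that chart_inv_chart[OF N charts_atD(1)[OF \<kappa>]] chart_inv_chart[OF M charts_atD(1)[OF \<kappa>']]
    by (auto simp: chart_rep_def A_def)
  have rep_x: "chart_rep F \<kappa> \<kappa>' (snd \<kappa> x) = snd \<kappa>' (F x)"
    using chart_inv_chart[OF N charts_atD[OF \<kappa>]] by (simp add: chart_rep_def)
  have "((chart_rep G \<kappa>' \<kappa>'' \<circ> chart_rep F \<kappa> \<kappa>') has_derivative
      (frechet_derivative (chart_rep G \<kappa>' \<kappa>'') (at (snd \<kappa>' (F x))) \<circ>
       frechet_derivative (chart_rep F \<kappa> \<kappa>') (at (snd \<kappa> x)))) (at (snd \<kappa> x))"
    using chart_rep_has_derivative[OF F \<kappa> \<kappa>'] chart_rep_has_derivative[OF G \<kappa>' \<kappa>'']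
    by (intro diff_chain_at) (simp_all add: rep_x)
  then have "(chart_rep (G \<circ> F) \<kappa> \<kappa>'' has_derivative
      (frechet_derivative (chart_rep G \<kappa>' \<kappa>'') (at (snd \<kappa>' (F x))) \<circ>
       frechet_derivative (chart_rep F \<kappa> \<kappa>') (at (snd \<kappa> x)))) (at (snd \<kappa> x))"
    by (rule has_derivative_transform_within_open[OF _ op])
       (use \<open>x \<in> A\<close> charts_atD[OF \<kappa>] eq in auto)
  from frechet_derivative_at[OF this] show ?thesis
    by (metis comp_apply)
qed

section \<open>Differentials of smooth maps\<close>

text \<open>Compatibility between target charts is the chain rule with the identity as second map.
  Since \<open>v\<close> is a bare coordinate vector in \<open>\<kappa>\<close>, the case
  \<open>F = id\<close> also turns any model vector into a tangent vector.\<close>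

lemma pushforward_in_tangent_space:
  assumes "smooth_manifold N" "smooth_manifold M" "smooth_map N M F" "\<kappa> \<in> charts_at N x"
  shows "(\<lambda>\<kappa>'. if \<kappa>' \<in> charts_at M (F x)
            then frechet_derivative (chart_rep F \<kappa> \<kappa>') (at (snd \<kappa> x)) v else 0)
         \<in> tangent_space M (F x)"
proof -
  have chain: "frechet_derivative (chart_rep F \<kappa> \<kappa>2) (at (snd \<kappa> x)) v =
      frechet_derivative (transition \<kappa>1 \<kappa>2) (at (snd \<kappa>1 (F x)))
        (frechet_derivative (chart_rep F \<kappa> \<kappa>1) (at (snd \<kappa> x)) v)"
    if "\<kappa>1 \<in> charts_at M (F x)" "\<kappa>2 \<in> charts_at M (F x)" for \<kappa>1 \<kappa>2
    using chart_rep_compose_derivative[OF assms(1-3) smooth_map_id[OF assms(2)] assms(4) that(1)] that(2)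
    unfolding chart_rep_id id_comp id_apply by blast
  show ?thesis
    unfolding tangent_space_def
    by (intro CollectI conjI allI ballI impI) (simp_all only: if_True if_False chain[symmetric])
qed

text \<open>Resolves the choice operator in \<open>differential\<close>. One chart serves every
  \<open>v\<close>, so linearity in \<open>v\<close> can be read off from a single
  derivative.\<close>

lemma differential_eq:
  assumes "smooth_manifold N" "x \<in> points N"
  obtains \<kappa> where "\<kappa> \<in> charts_at N x"
    "\<And>v. differential N M F x v =
       (\<lambda>\<kappa>'. if \<kappa>' \<in> charts_at M (F x)
             then frechet_derivative (chart_rep F \<kappa> \<kappa>') (at (snd \<kappa> x)) (v \<kappa>) else 0)"
proof -
  have "(SOME \<kappa>. \<kappa> \<in> charts_at N x) \<in> charts_at N x"
    using charts_at_nonempty[OF assms] by (metis someI)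
  then show ?thesis
    by (rule that) (simp add: differential_def chart_rep_def Let_def cong: if_cong)
qed

lemma differential_in_tangent_space:
  assumes "smooth_manifold N" "smooth_manifold M" "smooth_map N M F" "x \<in> points N"
  shows "differential N M F x v \<in> tangent_space M (F x)"
proof -
  obtain \<kappa> where "\<kappa> \<in> charts_at N x"
    "\<And>v. differential N M F x v =
       (\<lambda>\<kappa>'. if \<kappa>' \<in> charts_at M (F x)
             then frechet_derivative (chart_rep F \<kappa> \<kappa>') (at (snd \<kappa> x)) (v \<kappa>) else 0)"
    by (rule differential_eq[OF assms(1,4), where M = M and F = F]) (rule that)
  then show ?thesis
    using pushforward_in_tangent_space[OF assms(1-3)] by simp
qed

text \<open>Linearity in the form needed for the identity
  \<open>\<phi>\<^sup>2 v = v - \<eta>(v) \<xi>\<close>.\<close>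

lemma differential_tdiff_tscale:
  assumes "smooth_manifold N" "smooth_map N M F" "x \<in> points N"
  shows "differential N M F x (tdiff v (tscale c w)) =
         tdiff (differential N M F x v) (tscale c (differential N M F x w))"
proof -
  obtain \<kappa> where \<kappa>: "\<kappa> \<in> charts_at N x"
    and d: "\<And>v. differential N M F x v =
       (\<lambda>\<kappa>'. if \<kappa>' \<in> charts_at M (F x)
             then frechet_derivative (chart_rep F \<kappa> \<kappa>') (at (snd \<kappa> x)) (v \<kappa>) else 0)"
    by (rule differential_eq[OF assms(1,3), where M = M and F = F]) (rule that)
  have lin: "linear (frechet_derivative (chart_rep F \<kappa> \<kappa>') (at (snd \<kappa> x)))"
    if "\<kappa>' \<in> charts_at M (F x)" for \<kappa>'
    using chart_rep_has_derivative[OF assms(2) \<kappa> that] by (rule has_derivative_linear)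
  show ?thesis
    unfolding d tdiff_def tscale_def by (auto simp: fun_eq_iff linear_diff linear_scale lin)
qed

section \<open>From a vanishing differential to a constant map\<close>

text \<open>\<open>differential\<close> sees only its own chosen chart \<open>\<kappa>0\<close>, and
  that chart may vary with the point. The chain rule carries the vanishing over to a prescribed
  chart \<open>\<kappa>\<close>, which can then be kept fixed on a neighbourhood.\<close>

lemma differential_zero_imp_chart_rep_derivative_zero:
  assumes N: "smooth_manifold N" and F: "smooth_map N M F" and M: "smooth_manifold M"
    and x: "x \<in> points N" and zero: "\<forall>v\<in>tangent_space N x. differential N M F x v = tzero"
    and \<kappa>: "\<kappa> \<in> charts_at N x" and \<kappa>': "\<kappa>' \<in> charts_at M (F x)"
  shows "(chart_rep F \<kappa> \<kappa>' has_derivative (\<lambda>h. 0)) (at (snd \<kappa> x))"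
proof -
  obtain \<kappa>0 where \<kappa>0: "\<kappa>0 \<in> charts_at N x"
    and d: "\<And>v. differential N M F x v =
       (\<lambda>\<kappa>'. if \<kappa>' \<in> charts_at M (F x)
             then frechet_derivative (chart_rep F \<kappa>0 \<kappa>') (at (snd \<kappa>0 x)) (v \<kappa>0) else 0)"
    by (rule differential_eq[OF N x, where M = M and F = F]) (rule that)
  have "frechet_derivative (chart_rep F \<kappa> \<kappa>') (at (snd \<kappa> x)) h = 0" for h
  proof -
    \<comment> \<open>The tangent vector whose coordinate vector in \<open>\<kappa>\<close> is
      \<open>h\<close>: the pushforward of \<open>h\<close> under the identity.\<close>
    define v where "v = (\<lambda>\<kappa>1. if \<kappa>1 \<in> charts_at N x
      then frechet_derivative (chart_rep id \<kappa> \<kappa>1) (at (snd \<kappa> x)) h else 0)"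
    have "v \<in> tangent_space N x"
      using pushforward_in_tangent_space[OF N N smooth_map_id[OF N] \<kappa>] unfolding v_def id_apply .
    then have "frechet_derivative (chart_rep F \<kappa>0 \<kappa>') (at (snd \<kappa>0 x)) (v \<kappa>0) = 0"
      using zero \<kappa>' unfolding d tzero_def by (auto dest!: bspec fun_cong[where x = \<kappa>'])
    then show ?thesis
      using chart_rep_compose_derivative[OF N N smooth_map_id[OF N] F \<kappa>, of \<kappa>0 \<kappa>' h] \<kappa>0 \<kappa>'
      unfolding v_def comp_id id_apply by simp
  qed
  then have "frechet_derivative (chart_rep F \<kappa> \<kappa>') (at (snd \<kappa> x)) = (\<lambda>h. 0)" ..
  then show ?thesis
    using chart_rep_has_derivative[OF F \<kappa> \<kappa>'] by simp
qed

text \<open>In coordinates the map has zero derivative on a ball, which is convex, so it is constant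
  there; injectivity of the target chart brings this back to \<open>F\<close>.\<close>

lemma differential_zero_imp_locally_constant:
  assumes N: "smooth_manifold N" and M: "smooth_manifold M" and F: "smooth_map N M F"
    and zero: "\<forall>x\<in>points N. \<forall>v\<in>tangent_space N x. differential N M F x v = tzero"
    and x: "x \<in> points N"
  shows "\<exists>U. openin (mtop N) U \<and> x \<in> U \<and> (\<forall>y\<in>U. F y = F x)"
proof -
  have "F x \<in> points M"
    using F x by (rule smooth_map_points)
  then obtain \<kappa>' where \<kappa>': "\<kappa>' \<in> charts_at M (F x)"
    using charts_at_nonempty[OF M] by blast
  obtain \<kappa> where \<kappa>: "\<kappa> \<in> charts_at N x"
    using charts_at_nonempty[OF N x] by blast
  define A where "A = {y \<in> points N. F y \<in> fst \<kappa>'}"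
  have "x \<in> A"
    using x charts_atD[OF \<kappa>'] by (simp add: A_def)
  have Aop: "openin (mtop N) A"
    unfolding A_def by (rule smooth_map_preimage_openin[OF M F charts_atD(1)[OF \<kappa>']])
  then have "open (snd \<kappa> ` (fst \<kappa> \<inter> A))"
    using chart_image_open[OF N charts_atD(1)[OF \<kappa>]] by blast
  moreover have "snd \<kappa> x \<in> snd \<kappa> ` (fst \<kappa> \<inter> A)"
    using \<open>x \<in> A\<close> charts_atD[OF \<kappa>] by blast
  ultimately obtain e where e: "e > 0" "ball (snd \<kappa> x) e \<subseteq> snd \<kappa> ` (fst \<kappa> \<inter> A)"
    by (meson open_contains_ball)
  define U where "U = {y \<in> topspace (subtopology (mtop N) (fst \<kappa>)). snd \<kappa> y \<in> ball (snd \<kappa> x) e}"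
  have "openin (top_of_set (snd \<kappa> ` fst \<kappa>)) (ball (snd \<kappa> x) e)"
    using e(2) by (intro open_subset) auto
  then have "openin (subtopology (mtop N) (fst \<kappa>)) U"
    unfolding U_def
    by (rule openin_continuous_map_preimage
        [OF homeomorphic_imp_continuous_map[OF chart_homeo[OF N charts_atD(1)[OF \<kappa>]]]])
  then have "openin (mtop N) U"
    using openin_trans_full chart_openin[OF N charts_atD(1)[OF \<kappa>]] by blast
  moreover have "x \<in> U"
    using e(1) x charts_atD[OF \<kappa>] by (simp add: U_def)
  moreover have "F y = F x" if "y \<in> U" for y
  proof -
    have y: "y \<in> fst \<kappa>" "snd \<kappa> y \<in> ball (snd \<kappa> x) e"
      using that by (auto simp: U_def)
    have "snd \<kappa> y \<in> snd \<kappa> ` (fst \<kappa> \<inter> A)"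
      using y(2) e(2) by (rule rev_subsetD)
    then obtain z where z: "snd \<kappa> y = snd \<kappa> z" "z \<in> fst \<kappa>" "z \<in> A"
      by blast
    \<comment> \<open>The ball lies in the image of \<open>fst \<kappa> \<inter> A\<close>;
      injectivity of the chart shows that \<open>y\<close> itself, and not merely some point with
      the same coordinates, is in \<open>A\<close>.\<close>
    have "y = z"
      using chart_inj[OF N charts_atD(1)[OF \<kappa>]] z(1) y(1) z(2) by (rule inj_onD)
    then have "y \<in> A"
      using z(3) by simp
    \<comment> \<open>Here the differential has to vanish at every point over the ball, not only at
      \<open>x\<close>.\<close>
    have "(chart_rep F \<kappa> \<kappa>' has_derivative (\<lambda>h. 0)) (at u within ball (snd \<kappa> x) e)"
      if u: "u \<in> ball (snd \<kappa> x) e" for u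
    proof -
      obtain z where "u = snd \<kappa> z" "z \<in> fst \<kappa>" "z \<in> A"
        using u e(2) by blast
      then have "(chart_rep F \<kappa> \<kappa>' has_derivative (\<lambda>h. 0)) (at u)"
        using differential_zero_imp_chart_rep_derivative_zero[OF N F M, of z \<kappa> \<kappa>'] zero
          charts_atD[OF \<kappa>] charts_atD[OF \<kappa>']
        by (simp add: A_def charts_at_def)
      then show ?thesis
        by (rule has_derivative_at_withinI)
    qed
    then obtain c where "\<And>u. u \<in> ball (snd \<kappa> x) e \<Longrightarrow> chart_rep F \<kappa> \<kappa>' u = c"
      using has_derivative_zero_constant[OF convex_ball, of "snd \<kappa> x" e "chart_rep F \<kappa> \<kappa>'"] by blast
    then have "chart_rep F \<kappa> \<kappa>' (snd \<kappa> y) = chart_rep F \<kappa> \<kappa>' (snd \<kappa> x)"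
      using y e(1) by simp
    then have "snd \<kappa>' (F y) = snd \<kappa>' (F x)"
      using y chart_inv_chart[OF N charts_atD(1)[OF \<kappa>]] charts_atD[OF \<kappa>]
      by (simp add: chart_rep_def)
    then show ?thesis
      using inj_onD[OF chart_inj[OF M charts_atD(1)[OF \<kappa>']]] \<open>y \<in> A\<close> \<open>x \<in> A\<close>
      by (simp add: A_def)
  qed
  ultimately show ?thesis
    by blast
qed

text \<open>A level set of a locally constant function is clopen.\<close>

lemma connected_locally_constant_imp_constant_on:
  assumes "connected_space X"
    and loc: "\<And>x. x \<in> topspace X \<Longrightarrow> \<exists>U. openin X U \<and> x \<in> U \<and> (\<forall>y\<in>U. f y = f x)"
  shows "f constant_on topspace X"
proof (cases "topspace X = {}")
  case True
  then show ?thesis by (simp add: constant_on_def)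
next
  case False
  then obtain a where a: "a \<in> topspace X"
    by blast
  \<comment> \<open>The predicate \<open>P\<close> is arbitrary so that the same argument covers a
    level set and its complement.\<close>
  have op: "openin X {x \<in> topspace X. P (f x)}" for P
  proof (rule openin_subopen[THEN iffD2], rule ballI)
    fix x
    assume "x \<in> {x \<in> topspace X. P (f x)}"
    then have x: "x \<in> topspace X" "P (f x)"
      by simp_all
    obtain U where U: "openin X U" "x \<in> U" "\<forall>y\<in>U. f y = f x"
      using loc[OF x(1)] by blast
    have "y \<in> {x \<in> topspace X. P (f x)}" if "y \<in> U" for y
      using U(3)[rule_format, OF that] x(2) openin_subset[OF U(1)] that by fastforce
    then have "U \<subseteq> {x \<in> topspace X. P (f x)}"
      by blast
    then show "\<exists>T. openin X T \<and> x \<in> T \<and> T \<subseteq> {x \<in> topspace X. P (f x)}"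
      using U by blast
  qed
  have "topspace X - {x \<in> topspace X. f x = f a} = {x \<in> topspace X. f x \<noteq> f a}"
    by blast
  then have "closedin X {x \<in> topspace X. f x = f a}"
    using op[of "\<lambda>z. z \<noteq> f a"] by (simp add: closedin_def)
  then have "{x \<in> topspace X. f x = f a} = topspace X"
    using assms(1) op[of "\<lambda>z. z = f a"] a unfolding connected_space_clopen_in by blast
  then show ?thesis
    unfolding constant_on_def by blast
qed

section \<open>Pointwise algebra of the metallic structure\<close>

text \<open>Applying the quadratic relation to \<open>J w\<close> leaves \<open>q J w = 0\<close>,
  and applying it to \<open>w\<close> then leaves \<open>q w = 0\<close>. It is used for the image
  of \<open>\<xi>\<close>.\<close>

lemma metallic_square_zero_imp_zero:
  assumes J: "metallic_riemannian_manifold M g J p q" and x: "x \<in> points M"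
    and w: "w \<in> tangent_space M x" and sq: "J x (J x w) = tzero"
  shows "w = tzero"
proof -
  have Jw: "J x w \<in> tangent_space M x"
    and poly: "\<And>v. v \<in> tangent_space M x \<Longrightarrow>
      J x (J x v) = tadd (tscale (real p) (J x v)) (tscale (real q) v)"
    and hom: "\<And>v c. v \<in> tangent_space M x \<Longrightarrow> J x (tscale c v) = tscale c (J x v)"
    and q: "q > 0"
    using J x w unfolding metallic_riemannian_manifold_def tensor_field_11_def by blast+
  \<comment> \<open>Zero is written as \<open>tscale 0 w\<close> so that homogeneity of
    \<open>J\<close> gives \<open>J 0 = 0\<close>.\<close>
  have "J x (J x (J x w)) = J x (tscale 0 w)"
    unfolding sq by (simp add: tscale_def tzero_def)
  also have "\<dots> = tzero"
    unfolding hom[OF w] by (simp add: tscale_def tzero_def)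
  finally have "J x w = tzero"
    using poly[OF Jw] sq q by (simp add: tadd_def tscale_def tzero_def fun_eq_iff)
  then show ?thesis
    using poly[OF w] sq q by (simp add: tadd_def tscale_def tzero_def fun_eq_iff)
qed

text \<open>Comparing \<open>J\<^sup>2 w = w\<close> with the quadratic relation makes
  \<open>w\<close> satisfy \<open>J w = c w\<close> for \<open>c = (1 - q) / p\<close>, hence
  \<open>w = c\<^sup>2 w\<close>.\<close>

lemma metallic_involutive_imp_zero:
  assumes J: "metallic_riemannian_manifold M g J p q" and x: "x \<in> points M"
    and w: "w \<in> tangent_space M x" and sq: "J x (J x w) = w"
    and pq: "(int p)\<^sup>2 \<noteq> (int q - 1)\<^sup>2"
  shows "w = tzero"
proof -
  define c where "c = (1 - real q) / real p"
  have poly: "J x (J x w) = tadd (tscale (real p) (J x w)) (tscale (real q) w)"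
    and hom: "J x (tscale c w) = tscale c (J x w)"
    and p: "p > 0"
    using J x w unfolding metallic_riemannian_manifold_def tensor_field_11_def by blast+
  have pJ: "real p *\<^sub>R J x w \<kappa> = (1 - real q) *\<^sub>R w \<kappa>" for \<kappa>
    using fun_cong[OF poly, of \<kappa>] sq by (simp add: tadd_def tscale_def algebra_simps)
  have Jw: "J x w = tscale c w"
  proof
    fix \<kappa>
    have "J x w \<kappa> = (1 / real p) *\<^sub>R (real p *\<^sub>R J x w \<kappa>)"
      using p by simp
    then show "J x w \<kappa> = tscale c w \<kappa>"
      unfolding pJ by (simp add: c_def tscale_def)
  qed
  have "w = tscale c (tscale c w)"
    using sq hom unfolding Jw by simp
  then have fixed: "w \<kappa> = c\<^sup>2 *\<^sub>R w \<kappa>" for \<kappa>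
    by (metis tscale_def scaleR_scaleR power2_eq_square)
  \<comment> \<open>Over the reals, division by \<open>p\<^sup>2\<close> turns the hypothesis into
    \<open>c\<^sup>2 \<noteq> 1\<close>.\<close>
  have "real_of_int ((int p)\<^sup>2) \<noteq> real_of_int ((int q - 1)\<^sup>2)"
    using pq by (simp only: of_int_eq_iff not_False_eq_True)
  then have "c\<^sup>2 \<noteq> 1"
    using p by (simp add: c_def power_divide power2_commute)
  then have "w \<kappa> = 0" for \<kappa>
    using fixed[of \<kappa>] by (metis scaleR_cancel_right scaleR_one)
  then show ?thesis
    by (simp add: tzero_def fun_eq_iff)
qed

theorem theorem4p10:
  fixes N :: "('a, 'e::real_normed_vector) manifold"
    and M\<^sub>1 :: "('b, 'f::real_normed_vector) manifold"
    and F :: "'a \<Rightarrow> 'b"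
    and n p q :: nat
  assumes "almost_paracontact_metric_manifold N n \<phi> \<xi> \<eta> g"
    and "connected_space (mtop N)"
    and "metallic_riemannian_manifold M\<^sub>1 g\<^sub>1 J\<^sub>1 p q"
    and "smooth_map N M\<^sub>1 F"
    and "\<forall>x\<in>points N. \<forall>v\<in>tangent_space N x.
           differential N M\<^sub>1 F x (\<phi> x v) = J\<^sub>1 (F x) (differential N M\<^sub>1 F x v)"
    and "(int p)\<^sup>2 \<noteq> (int q - 1)\<^sup>2"
  shows "F constant_on points N"
proof -
  have N: "smooth_manifold N" and M: "smooth_manifold M\<^sub>1"
    and \<xi>: "vector_field N \<xi>"
    and \<phi>_tangent: "\<And>x v. x \<in> points N \<Longrightarrow> v \<in> tangent_space N x \<Longrightarrow> \<phi> x v \<in> tangent_space N x"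
    and \<phi>_sq: "\<And>x v. x \<in> points N \<Longrightarrow> v \<in> tangent_space N x \<Longrightarrow>
      \<phi> x (\<phi> x v) = tdiff v (tscale (\<eta> x v) (\<xi> x))"
    and \<eta>\<xi>: "\<And>x. x \<in> points N \<Longrightarrow> \<eta> x (\<xi> x) = 1"
    using assms(1,3)
    unfolding almost_paracontact_metric_manifold_def metallic_riemannian_manifold_def
      tensor_field_11_def by blast+
  have zero: "differential N M\<^sub>1 F x v = tzero" if x: "x \<in> points N" and v: "v \<in> tangent_space N x" for x v
  proof -
    let ?D = "differential N M\<^sub>1 F x"
    have Fx: "F x \<in> points M\<^sub>1"
      using assms(4) x by (rule smooth_map_points)
    have D_tangent: "?D u \<in> tangent_space M\<^sub>1 (F x)" for u
      using differential_in_tangent_space[OF N M assms(4) x] .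
    \<comment> \<open>The intertwining relation is applied twice, first to \<open>\<phi> x u\<close>
      and then to \<open>u\<close>.\<close>
    have J_sq: "J\<^sub>1 (F x) (J\<^sub>1 (F x) (?D u)) = tdiff (?D u) (tscale (\<eta> x u) (?D (\<xi> x)))"
      if u: "u \<in> tangent_space N x" for u
      using assms(5) x u \<phi>_tangent[OF x u] \<phi>_sq[OF x u] differential_tdiff_tscale[OF N assms(4) x]
      by metis
    have \<xi>x: "\<xi> x \<in> tangent_space N x"
      using \<xi> x unfolding vector_field_def by blast
    \<comment> \<open>For \<open>u = \<xi> x\<close> the coefficient is 1 and the difference
      cancels. Once the image of \<open>\<xi> x\<close> is known to be zero, the correction term in
      \<open>J_sq\<close> disappears for every \<open>v\<close>.\<close>
    have "J\<^sub>1 (F x) (J\<^sub>1 (F x) (?D (\<xi> x))) = tzero"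
      unfolding J_sq[OF \<xi>x] \<eta>\<xi>[OF x] by (simp add: tdiff_def tscale_def tzero_def)
    then have "?D (\<xi> x) = tzero"
      by (rule metallic_square_zero_imp_zero[OF assms(3) Fx D_tangent])
    then have "J\<^sub>1 (F x) (J\<^sub>1 (F x) (?D v)) = ?D v"
      unfolding J_sq[OF v] by (simp add: tdiff_def tscale_def tzero_def)
    then show ?thesis
      by (rule metallic_involutive_imp_zero[OF assms(3) Fx D_tangent _ assms(6)])
  qed
  show ?thesis
    using assms(2)
  proof (rule connected_locally_constant_imp_constant_on)
    show "\<exists>U. openin (mtop N) U \<and> x \<in> U \<and> (\<forall>y\<in>U. F y = F x)" if "x \<in> points N" for x
      using differential_zero_imp_locally_constant[OF N M assms(4) _ that] zero by blast
  qed
qed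

end
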